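(* Let $f:\mathbb{R}^d\to\mathbb{R}$ be bounded below with $L$-Lipschitz gradient and satisfy the $\alpha$-PŁ condition with some $\alpha\in[1,2]$, $\mu>0$. Let the stochastic gradient estimators $g_k(x,\xi)$ satisfy the expected smoothness condition of order $k$ with $h(t)=t^\beta$, $\beta\in(0,1]$, and cost $b_k=\Theta(k^\tau)$, $\tau\ge0$. Let $\gamma:=\alpha\beta$. Then SGD with restarts with inner-loop length $T=\Theta(1)$ and step-sizes - $\eta_k=\Theta(k^{-1})$ if $\gamma=2$; - $\eta_k=\Theta\big(k^{-\frac{\tau+1}{2-\alpha/2}+\tau}\big)$ if $\gamma<2$ and $\tau\le\frac{\gamma}{4-\alpha-\gamma}$; - $\eta_k=\Theta\big(k^{-\frac{2-\gamma}{4-\alpha-\gamma}}\big)$ if $\gamma<2$ and $\tau>\frac{\gamma}{4-\alpha-\gamma}$ (with suitable constants) finds a point $x$ with $\mathbb{E}[f(x)-f^*]\le\epsilon_f$ with expected total computational cost (sample complexity) $$\text{cost}:=T\cdot\sum_{k=0}^{K-1}b_k=\begin{cases}\mathcal{O}\Big(\epsilon_f^{-\frac{4-\alpha}{\alpha}}\Big)&\text{for }0\le\tau\le\frac{\gamma}{4-\alpha-\gamma},\\[4pt]\mathcal{O}\Big(\epsilon_f^{-\frac{(4-\alpha-\gamma)(\tau+1)}{\alpha}}\Big)&\text{for }\tau>\frac{\gamma}{4-\alpha-\gamma}.\end{cases}$$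
   Context: $f^*:=\inf_x f(x)>-\infty$. $\alpha$-PŁ condition: there are $\alpha\in[1,2]$ and $\mu>0$ with $\|\nabla f(x)\|^\alpha\ge(2\mu)^{\alpha/2}(f(x)-f^* )$ for all $x\in\mathbb{R}^d$. Expected smoothness of order $k$ (with function $h$): $g_k(x,\xi)$ is an unbiased estimator of $\nabla f(x)$ (expectation over $\xi\sim\mathcal{D}$) and $$\mathbb{E}\|g_k(x,\xi)\|^2\le 2A\,h(f(x)-f^* )+B\|\nabla f(x)\|^2+\frac{C}{b_k}\quad\text{for all }x\in\mathbb{R}^d,$$ with constants $A,B,C\ge0$; $b_k$ is the cost of one evaluation of $g_k$. SGD with restarts: given an initial $x$, integers $T,K$ and step-sizes $\{\eta_k\}$, for each outer iteration $k=0,\dots,K-1$ perform $T$ inner updates $x\leftarrow x-\eta_k\,g_k(x,\xi_t)$, $t=0,\dots,T-1$, with independent random vectors $\xi_t$; return the final $x$. Expressions such as $\Theta(k^\tau)$ refer to $k\ge1$; $b_0,\eta_0$ are positive constants. In the case $\gamma=2$ (so $\alpha=2$, $\beta=1$) the threshold $\frac{\gamma}{4-\alpha-\gamma}$ is read as $+\infty$. Hidden constants do not depend on $\epsilon_f$ or $k$. *)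

theory Defs
  imports "HOL-Probability.Probability" "HOL-Library.Landau_Symbols"
begin

definition fstar :: "('a \<Rightarrow> real) \<Rightarrow> real" where
  "fstar f = (INF x. f x)"

definition PL_condition ::
  "real \<Rightarrow> real \<Rightarrow> ('a::real_normed_vector \<Rightarrow> real) \<Rightarrow> ('a \<Rightarrow> 'a) \<Rightarrow> bool" where
  "PL_condition \<alpha> \<mu> f grad_f \<longleftrightarrow>
     (\<forall>x. norm (grad_f x) powr \<alpha> \<ge> (2 * \<mu>) powr (\<alpha> / 2) * (f x - fstar f))"

text \<open>
  Joint measurability makes the iterates random variables. Integrability is required explicitly
  because the Bochner integral of a non-integrable function is 0.
\<close>

definition expected_smoothness ::
  "'s measure \<Rightarrow> (real \<Rightarrow> real) \<Rightarrow> real \<Rightarrow> real \<Rightarrow> real \<Rightarrow> real \<Rightarrow>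
   ('a::euclidean_space \<Rightarrow> real) \<Rightarrow> ('a \<Rightarrow> 'a) \<Rightarrow> ('a \<Rightarrow> 's \<Rightarrow> 'a) \<Rightarrow> bool" where
  "expected_smoothness D h A B C bk f grad_f gk \<longleftrightarrow>
     (\<lambda>(x, s). gk x s) \<in> borel_measurable (borel \<Otimes>\<^sub>M D) \<and>
     (\<forall>x. integrable D (gk x) \<and> (\<integral>s. gk x s \<partial>D) = grad_f x) \<and>
     (\<forall>x. integrable D (\<lambda>s. (norm (gk x s))\<^sup>2) \<and>
          (\<integral>s. (norm (gk x s))\<^sup>2 \<partial>D)
            \<le> 2 * A * h (f x - fstar f) + B * (norm (grad_f x))\<^sup>2 + C / bk)"

primrec sgd_inner ::
  "('a::real_vector \<Rightarrow> 's \<Rightarrow> 'a) \<Rightarrow> real \<Rightarrow> (nat \<Rightarrow> 's) \<Rightarrow> nat \<Rightarrow> 'a \<Rightarrow> 'a" where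
  "sgd_inner gk \<eta>k s 0 x = x"
| "sgd_inner gk \<eta>k s (Suc t) x =
     (let y = sgd_inner gk \<eta>k s t x in y - \<eta>k *\<^sub>R gk y (s t))"

text \<open>The sample \<open>s k t\<close> is used in inner step \<open>t\<close> of outer iteration \<open>k\<close>.\<close>

primrec sgd_restarts ::
  "(nat \<Rightarrow> 'a::real_vector \<Rightarrow> 's \<Rightarrow> 'a) \<Rightarrow> (nat \<Rightarrow> real) \<Rightarrow> (nat \<Rightarrow> nat \<Rightarrow> 's) \<Rightarrow>
   nat \<Rightarrow> nat \<Rightarrow> 'a \<Rightarrow> 'a" where
  "sgd_restarts g \<eta> s T 0 x = x"
| "sgd_restarts g \<eta> s T (Suc k) x =
     sgd_inner (g k) (\<eta> k) (s k) T (sgd_restarts g \<eta> s T k x)"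

text \<open>
  For \<open>\<alpha> \<in> [1, 2]\<close>, \<open>\<beta> \<in> (0, 1]\<close> and \<open>\<gamma> = \<alpha> \<beta>\<close>, the denominator \<open>4 - \<alpha> - \<gamma>\<close>
  vanishes exactly when \<open>\<gamma> = 2\<close>.
\<close>

definition tau_threshold :: "real \<Rightarrow> real \<Rightarrow> ereal" where
  "tau_threshold \<alpha> \<gamma> = (if \<gamma> = 2 then \<infinity> else ereal (\<gamma> / (4 - \<alpha> - \<gamma>)))"

definition step_exponent :: "real \<Rightarrow> real \<Rightarrow> real \<Rightarrow> real" where
  "step_exponent \<alpha> \<gamma> \<tau> =
     (if \<gamma> = 2 then - 1
      else if ereal \<tau> \<le> tau_threshold \<alpha> \<gamma> then - ((\<tau> + 1) / (2 - \<alpha> / 2)) + \<tau>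
      else - ((2 - \<gamma>) / (4 - \<alpha> - \<gamma>)))"

definition cost_exponent :: "real \<Rightarrow> real \<Rightarrow> real \<Rightarrow> real" where
  "cost_exponent \<alpha> \<gamma> \<tau> =
     (if ereal \<tau> \<le> tau_threshold \<alpha> \<gamma> then - ((4 - \<alpha>) / \<alpha>)
      else - ((4 - \<alpha> - \<gamma>) * (\<tau> + 1) / \<alpha>))"

end

theory Submission
  imports Defs
begin

text \<open>
  Take \<open>T = 1\<close>. Smoothness, the PL inequality and Jensen's inequality turn one SGD step into a
  recursion for \<open>d\<^sub>k = E[f(x\<^sub>k) - f\<^sup>*]\<close>, with \<open>\<theta> = 2/\<alpha>\<close>:
  \<open>d\<^sub>k\<^sub>+\<^sub>1 \<le> d\<^sub>k - \<mu> \<eta>\<^sub>k d\<^sub>k\<^sup>\<theta> + L A \<eta>\<^sub>k\<^sup>2 d\<^sub>k\<^sup>\<beta> + L C \<eta>\<^sub>k\<^sup>2 / (2 b\<^sub>k)\<close>.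
  With \<open>\<eta>\<^sub>k \<sim> k\<^sup>-\<^sup>p\<close> and the ansatz \<open>d\<^sub>k \<le> R k\<^sup>-\<^sup>r\<close>, the contraction term has order
  \<open>p + r \<theta> = r + 1\<close>, the decrement of \<open>k\<^sup>-\<^sup>r\<close>, while the two noise terms have orders \<open>2 p + r \<beta>\<close>
  and \<open>2 p + \<tau>\<close>. The prescribed \<open>p\<close> is the one for which the smaller of these also equals
  \<open>r + 1\<close>. The cost of reaching accuracy
  \<open>\<epsilon>\<close> is then of order \<open>K\<^sup>\<tau>\<^sup>+\<^sup>1\<close> with \<open>K \<sim> \<epsilon>\<^sup>-\<^sup>1\<^sup>/\<^sup>r\<close>.

  The step-sizes must not depend on the starting point, but \<open>R\<close> does. The case in which \<open>R\<close> is so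
  large that the step \<open>d \<mapsto> d - \<mu> \<eta> d\<^sup>\<theta>\<close> is no longer monotone on \<open>[0, R k\<^sup>-\<^sup>r]\<close> is covered by the
  a priori bound \<open>\<mu> d\<^sup>\<theta> \<le> L d\<close>, which follows from \<open>2 \<mu> d\<^sup>\<theta> \<le> \<parallel>\<nabla>f\<parallel>\<^sup>2 \<le> 2 L d\<close>.
\<close>

section \<open>Tangent-line bounds and Jensen's inequality for real powers\<close>

lemma powr_le_tangent_one:
  fixes t p :: real
  assumes "0 \<le> t" "0 < p" "p \<le> 1"
  shows "t powr p \<le> 1 + p * (t - 1)"
proof (cases "t = 0")
  case False
  \<comment> \<open>Weighted AM-GM of \<open>t\<close> and 1 with weights \<open>p\<close> and
    \<open>1 - p\<close>.\<close>
  then show ?thesis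
    using Youngs_inequality_0[of p "1 - p" t 1] assms by (simp add: algebra_simps)
qed (use assms in auto)

text \<open>Follows from the concave case, applied to \<open>t powr p\<close> with exponent
  \<open>1 / p\<close>.\<close>

lemma powr_ge_tangent_one:
  fixes t p :: real
  assumes "0 \<le> t" "1 \<le> p"
  shows "1 + p * (t - 1) \<le> t powr p"
proof -
  have "(t powr p) powr (1 / p) \<le> 1 + (1 / p) * (t powr p - 1)"
    using assms by (intro powr_le_tangent_one) auto
  moreover have "(t powr p) powr (1 / p) = t"
    using assms by (simp add: powr_powr)
  ultimately show ?thesis
    using assms by (simp add: field_simps)
qed

context prob_space
begin

text \<open>The power lies above its tangent at the mean \<open>m\<close>. Scaling by
  \<open>m\<close> moves the point of tangency to 1, and the linear term integrates to 0.\<close>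

lemma expectation_powr_ge:
  fixes X :: "'a \<Rightarrow> real"
  assumes X: "integrable M X" "\<And>\<omega>. 0 \<le> X \<omega>"
    and Xp: "integrable M (\<lambda>\<omega>. X \<omega> powr p)" and p: "1 \<le> p"
  shows "expectation X powr p \<le> expectation (\<lambda>\<omega>. X \<omega> powr p)"
proof (cases "expectation X = 0")
  case False
  define m where "m = expectation X"
  have m: "0 < m"
    using False X by (simp add: m_def less_le)
  have *: "m powr p * (1 + p * (X \<omega> / m - 1)) \<le> X \<omega> powr p" for \<omega>
  proof -
    have "m powr p * (1 + p * (X \<omega> / m - 1)) \<le> m powr p * (X \<omega> / m) powr p"
      using X m p by (intro mult_left_mono powr_ge_tangent_one) auto
    also have "\<dots> = X \<omega> powr p"
      using X m by (simp add: powr_divide)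
    finally show ?thesis .
  qed
  have "m powr p = (\<integral>\<omega>. m powr p * (1 + p * (X \<omega> / m - 1)) \<partial>M)"
    using X m by (simp add: prob_space m_def[symmetric])
  also have "\<dots> \<le> expectation (\<lambda>\<omega>. X \<omega> powr p)"
    using X Xp * by (intro integral_mono) auto
  finally show ?thesis by (simp add: m_def)
qed simp

text \<open>The same tangent argument, reversed. Integrability is a conclusion here: a power with
  exponent at most 1 grows at most linearly, and the measure is finite.\<close>

lemma expectation_powr_le:
  fixes X :: "'a \<Rightarrow> real"
  assumes X: "integrable M X" "\<And>\<omega>. 0 \<le> X \<omega>" and p: "0 < p" "p \<le> 1"
  shows "integrable M (\<lambda>\<omega>. X \<omega> powr p)"
    and "expectation (\<lambda>\<omega>. X \<omega> powr p) \<le> expectation X powr p"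
proof -
  have [measurable]: "X \<in> borel_measurable M"
    using X by auto
  show int: "integrable M (\<lambda>\<omega>. X \<omega> powr p)"
  proof (rule Bochner_Integration.integrable_bound)
    show "integrable M (\<lambda>\<omega>. 1 + p * X \<omega>)"
      using X by auto
    show "AE \<omega> in M. norm (X \<omega> powr p) \<le> norm (1 + p * X \<omega>)"
    proof (rule AE_I2)
      fix \<omega>
      have "0 \<le> p * X \<omega>"
        using X p by simp
      then show "norm (X \<omega> powr p) \<le> norm (1 + p * X \<omega>)"
        using powr_le_tangent_one[of "X \<omega>" p] X p by (simp add: algebra_simps)
    qed
  qed auto
  show "expectation (\<lambda>\<omega>. X \<omega> powr p) \<le> expectation X powr p"
  proof (cases "expectation X = 0")
    case True
    then have "AE \<omega> in M. X \<omega> = 0"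
      using integral_nonneg_eq_0_iff_AE[OF X(1)] X(2) by simp
    then have "AE \<omega> in M. X \<omega> powr p = 0"
      by auto
    then show ?thesis
      using integral_eq_zero_AE by fastforce
  next
    case False
    define m where "m = expectation X"
    have m: "0 < m"
      using False X by (simp add: m_def less_le)
    have *: "X \<omega> powr p \<le> m powr p * (1 + p * (X \<omega> / m - 1))" for \<omega>
    proof -
      have "X \<omega> powr p = m powr p * (X \<omega> / m) powr p"
        using X m by (simp add: powr_divide)
      also have "\<dots> \<le> m powr p * (1 + p * (X \<omega> / m - 1))"
        using X m p by (intro mult_left_mono powr_le_tangent_one) auto
      finally show ?thesis .
    qed
    have "expectation (\<lambda>\<omega>. X \<omega> powr p) \<le> (\<integral>\<omega>. m powr p * (1 + p * (X \<omega> / m - 1)) \<partial>M)"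
      using X int * by (intro integral_mono) auto
    also have "\<dots> = m powr p"
      using X m by (simp add: prob_space m_def[symmetric])
    finally show ?thesis by (simp add: m_def)
  qed
qed

end

subsection \<open>Smooth functions with the PL inequality\<close>

text \<open>The descent lemma. Along the segment from \<open>x\<close> to \<open>y\<close>, the
  function minus its quadratic majorant is nonincreasing, by Cauchy-Schwarz and the Lipschitz
  bound.\<close>

lemma lipschitz_gradient_upper_bound:
  fixes f :: "'a::real_inner \<Rightarrow> real"
  assumes grad: "\<And>x. GDERIV f x :> df x" and lip: "L-lipschitz_on UNIV df"
  shows "f y \<le> f x + inner (df x) (y - x) + L / 2 * (norm (y - x))\<^sup>2"
proof -
  define v where "v = y - x"
  define \<psi> where "\<psi> t = f (x + t *\<^sub>R v) - t * inner (df x) v - L / 2 * t\<^sup>2 * (norm v)\<^sup>2" for t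
  have "\<psi> 1 \<le> \<psi> 0"
  proof (rule DERIV_nonpos_imp_nonincreasing[of 0 1 \<psi>])
    fix t :: real
    assume t: "0 \<le> t" "t \<le> 1"
    have *: "((\<lambda>t. f (x + t *\<^sub>R v)) has_derivative (\<lambda>h. inner (h *\<^sub>R v) (df (x + t *\<^sub>R v)))) (at t)"
      using grad[of "x + t *\<^sub>R v"] unfolding gderiv_def
      by (rule has_derivative_compose[rotated]) (auto intro!: derivative_eq_intros)
    have "DERIV (\<lambda>t. f (x + t *\<^sub>R v)) t :> inner v (df (x + t *\<^sub>R v))"
      unfolding has_field_derivative_def by (rule has_derivative_eq_rhs[OF *]) auto
    then have der: "DERIV \<psi> t :> inner v (df (x + t *\<^sub>R v)) - inner (df x) v - L * t * (norm v)\<^sup>2"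
      unfolding \<psi>_def by (auto intro!: derivative_eq_intros)
    have "inner v (df (x + t *\<^sub>R v)) - inner (df x) v = inner v (df (x + t *\<^sub>R v) - df x)"
      by (simp add: inner_diff_right inner_commute)
    also have "\<dots> \<le> norm v * norm (df (x + t *\<^sub>R v) - df x)"
      by (rule norm_cauchy_schwarz)
    also have "\<dots> \<le> norm v * (L * norm (t *\<^sub>R v))"
      using lipschitz_onD[OF lip, of "x + t *\<^sub>R v" x]
      by (intro mult_left_mono) (auto simp: dist_norm)
    also have "\<dots> = L * t * (norm v)\<^sup>2"
      using t by (simp add: power2_eq_square)
    finally show "\<exists>z. DERIV \<psi> t :> z \<and> z \<le> 0"
      using der by (intro exI conjI) auto
  qed auto
  then show ?thesis
    by (simp add: \<psi>_def v_def)
qed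

locale PL_smooth =
  fixes f :: "'a::euclidean_space \<Rightarrow> real" and df :: "'a \<Rightarrow> 'a" and L \<alpha> \<mu> :: real
  assumes bdd: "bdd_below (range f)"
    and gderiv: "\<And>x. GDERIV f x :> df x"
    and lipschitz_grad: "L-lipschitz_on UNIV df" and L_pos: "0 < L"
    and alpha_bounds: "1 \<le> \<alpha>" "\<alpha> \<le> 2" and mu: "0 < \<mu>"
    and PL: "PL_condition \<alpha> \<mu> f df"
begin

definition gap :: "'a \<Rightarrow> real" where
  "gap x = f x - fstar f"

lemma gap_nonneg: "0 \<le> gap x"
  unfolding gap_def fstar_def using cINF_lower[OF bdd] by simp

lemma measurable_gap [measurable]: "gap \<in> borel_measurable borel"
proof -
  have "continuous_on UNIV f"
    using gderiv unfolding gderiv_def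
    by (meson continuous_at_imp_continuous_on has_derivative_continuous)
  then show ?thesis
    unfolding gap_def by (intro borel_measurable_diff borel_measurable_continuous_onI) auto
qed

lemma gap_step_le:
  "gap (x - h *\<^sub>R v) \<le> gap x - h * inner (df x) v + L / 2 * h\<^sup>2 * (norm v)\<^sup>2"
  using lipschitz_gradient_upper_bound[OF gderiv lipschitz_grad, of "x - h *\<^sub>R v" x]
  by (simp add: gap_def power_mult_distrib)

text \<open>A gradient step of length \<open>1 / L\<close> lowers the gap by at least
  \<open>(norm (df x))\<^sup>2 / (2 * L)\<close>, and the gap cannot become negative.\<close>

lemma gradient_norm_sq_le: "(norm (df x))\<^sup>2 \<le> 2 * L * gap x"
proof -
  have "0 \<le> gap (x - (1 / L) *\<^sub>R df x)"
    by (rule gap_nonneg)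
  also have "\<dots> \<le> gap x - 1 / L * inner (df x) (df x) + L / 2 * (1 / L)\<^sup>2 * (norm (df x))\<^sup>2"
    by (rule gap_step_le)
  also have "\<dots> = gap x - (norm (df x))\<^sup>2 / (2 * L)"
    using L_pos by (simp add: dot_square_norm power2_eq_square field_simps)
  finally show ?thesis
    using L_pos by (simp add: field_simps)
qed

text \<open>The PL inequality raised to the power \<open>2 / \<alpha>\<close>, to match the squared
  norm in the descent estimate.\<close>

lemma gradient_norm_sq_ge: "2 * \<mu> * gap x powr (2 / \<alpha>) \<le> (norm (df x))\<^sup>2"
proof -
  have "(2 * \<mu>) powr (\<alpha> / 2) * gap x \<le> norm (df x) powr \<alpha>"
    using PL unfolding PL_condition_def gap_def by blast
  then have "((2 * \<mu>) powr (\<alpha> / 2) * gap x) powr (2 / \<alpha>) \<le> (norm (df x) powr \<alpha>) powr (2 / \<alpha>)"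
    using alpha_bounds mu gap_nonneg[of x] by (intro powr_mono2) auto
  then show ?thesis
    using alpha_bounds mu gap_nonneg[of x] by (simp add: powr_mult powr_powr)
qed

text \<open>A linear bound on a power with exponent at least 1. It yields integrability of that
  power and, in expectation, the a priori bound used in the scalar recursion.\<close>

lemma gap_powr_le: "\<mu> * gap x powr (2 / \<alpha>) \<le> L * gap x"
  using gradient_norm_sq_le[of x] gradient_norm_sq_ge[of x] by linarith

text \<open>By unbiasedness the linear term contributes \<open>- h * (norm (df x))\<^sup>2\<close>.
  Since \<open>L * B * h \<le> 1\<close>, half of it absorbs the \<open>B\<close> noise; the PL
  inequality turns the other half into the contraction term.\<close>

lemma expected_gap_step_le:
  assumes D: "prob_space D"
    and es: "expected_smoothness D (\<lambda>t. t powr \<beta>) A B C b f df G"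
    and h: "0 < h" "L * B * h \<le> 1"
  shows "integrable D (\<lambda>s. gap (x - h *\<^sub>R G x s))"
    and "(\<integral>s. gap (x - h *\<^sub>R G x s) \<partial>D)
           \<le> gap x - \<mu> * h * gap x powr (2 / \<alpha>) + L * A * h\<^sup>2 * gap x powr \<beta> + L * C / (2 * b) * h\<^sup>2"
proof -
  interpret D: prob_space D by fact
  have Gm: "(\<lambda>(x, s). G x s) \<in> borel_measurable (borel \<Otimes>\<^sub>M D)"
    and Gi: "integrable D (G x)" "(\<integral>s. G x s \<partial>D) = df x"
    and G2: "integrable D (\<lambda>s. (norm (G x s))\<^sup>2)"
    and G2_le: "(\<integral>s. (norm (G x s))\<^sup>2 \<partial>D) \<le> 2 * A * gap x powr \<beta> + B * (norm (df x))\<^sup>2 + C / b"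
    using es unfolding expected_smoothness_def gap_def by blast+
  have [measurable]: "G x \<in> borel_measurable D"
    using Gi(1) by auto
  define \<phi> where "\<phi> s = gap x - h * inner (df x) (G x s) + L / 2 * h\<^sup>2 * (norm (G x s))\<^sup>2" for s
  have \<phi>: "gap (x - h *\<^sub>R G x s) \<le> \<phi> s" for s
    unfolding \<phi>_def by (rule gap_step_le)
  have \<phi>_int: "integrable D \<phi>"
    unfolding \<phi>_def using Gi G2 by auto
  show int: "integrable D (\<lambda>s. gap (x - h *\<^sub>R G x s))"
    using order_trans[OF \<phi> abs_ge_self] gap_nonneg
    by (intro Bochner_Integration.integrable_bound[OF \<phi>_int] AE_I2) auto
  have "(\<integral>s. gap (x - h *\<^sub>R G x s) \<partial>D) \<le> (\<integral>s. \<phi> s \<partial>D)"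
    by (intro integral_mono int \<phi>_int \<phi>)
  also have "\<dots> = gap x - h * (norm (df x))\<^sup>2 + L / 2 * h\<^sup>2 * (\<integral>s. (norm (G x s))\<^sup>2 \<partial>D)"
    unfolding \<phi>_def using Gi G2 by (simp add: D.prob_space dot_square_norm)
  also have "\<dots> \<le> gap x - h * (norm (df x))\<^sup>2
      + L / 2 * h\<^sup>2 * (2 * A * gap x powr \<beta> + B * (norm (df x))\<^sup>2 + C / b)"
    using L_pos G2_le by (intro add_left_mono mult_left_mono) auto
  also have "\<dots> = gap x - h * (norm (df x))\<^sup>2 + (L * B * h) * (h / 2 * (norm (df x))\<^sup>2)
      + L * A * h\<^sup>2 * gap x powr \<beta> + L * C / (2 * b) * h\<^sup>2"
    by (simp add: algebra_simps power2_eq_square)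
  also have "\<dots> \<le> gap x - h * (norm (df x))\<^sup>2 + 1 * (h / 2 * (norm (df x))\<^sup>2)
      + L * A * h\<^sup>2 * gap x powr \<beta> + L * C / (2 * b) * h\<^sup>2"
    using h by (intro add_right_mono add_left_mono mult_right_mono) auto
  also have "\<dots> \<le> gap x - \<mu> * h * gap x powr (2 / \<alpha>) + L * A * h\<^sup>2 * gap x powr \<beta> + L * C / (2 * b) * h\<^sup>2"
    using mult_left_mono[OF gradient_norm_sq_ge[of x], of "h / 2"] h by (simp add: algebra_simps)
  finally show "(\<integral>s. gap (x - h *\<^sub>R G x s) \<partial>D)
    \<le> gap x - \<mu> * h * gap x powr (2 / \<alpha>) + L * A * h\<^sup>2 * gap x powr \<beta> + L * C / (2 * b) * h\<^sup>2" .
qed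

lemma gap_powr_integrable:
  assumes "integrable M (\<lambda>\<omega>. gap (X \<omega>))"
  shows "integrable M (\<lambda>\<omega>. gap (X \<omega>) powr (2 / \<alpha>))"
proof (rule Bochner_Integration.integrable_bound)
  show "integrable M (\<lambda>\<omega>. L / \<mu> * gap (X \<omega>))"
    using assms by simp
  have "gap x powr (2 / \<alpha>) \<le> L / \<mu> * gap x" for x
    using gap_powr_le[of x] mu by (simp add: field_simps)
  then show "AE \<omega> in M. norm (gap (X \<omega>) powr (2 / \<alpha>)) \<le> norm (L / \<mu> * gap (X \<omega>))"
    using gap_nonneg mu L_pos by (intro AE_I2) (simp add: abs_mult)
qed (use assms in auto)

lemma expectation_gap_powr_le:
  assumes M: "prob_space M" and X: "integrable M (\<lambda>\<omega>. gap (X \<omega>))"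
  shows "\<mu> * (\<integral>\<omega>. gap (X \<omega>) \<partial>M) powr (2 / \<alpha>) \<le> L * (\<integral>\<omega>. gap (X \<omega>) \<partial>M)"
proof -
  interpret M: prob_space M by fact
  have "\<mu> * (\<integral>\<omega>. gap (X \<omega>) \<partial>M) powr (2 / \<alpha>) \<le> \<mu> * (\<integral>\<omega>. gap (X \<omega>) powr (2 / \<alpha>) \<partial>M)"
    using X alpha_bounds mu gap_nonneg gap_powr_integrable[OF X]
    by (intro mult_left_mono M.expectation_powr_ge) auto
  also have "\<dots> = (\<integral>\<omega>. \<mu> * gap (X \<omega>) powr (2 / \<alpha>) \<partial>M)"
    by simp
  also have "\<dots> \<le> (\<integral>\<omega>. L * gap (X \<omega>) \<partial>M)"
    using X gap_powr_integrable[OF X] gap_powr_le by (intro integral_mono) auto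
  finally show ?thesis by simp
qed

text \<open>The product law \<open>joint\<close> does the work of conditioning on \<open>X\<close>:
  the bound at a fixed point is integrated over the law of \<open>X\<close>. Jensen then acts in
  both directions, convex for the subtracted power \<open>2 / \<alpha>\<close> and concave for the
  added power \<open>\<beta>\<close>.\<close>

lemma sgd_step_expectation:
  assumes M: "prob_space M" and D: "prob_space D"
    and X [measurable]: "X \<in> M \<rightarrow>\<^sub>M borel" and Z [measurable]: "Z \<in> M \<rightarrow>\<^sub>M D"
    and joint: "distr M (borel \<Otimes>\<^sub>M D) (\<lambda>\<omega>. (X \<omega>, Z \<omega>)) = distr M borel X \<Otimes>\<^sub>M D"
    and X_int: "integrable M (\<lambda>\<omega>. gap (X \<omega>))"
    and es: "expected_smoothness D (\<lambda>t. t powr \<beta>) A B C b f df G"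
    and h: "0 < h" "L * B * h \<le> 1" and beta: "0 < \<beta>" "\<beta> \<le> 1" and A: "0 \<le> A"
  defines "m \<equiv> \<integral>\<omega>. gap (X \<omega>) \<partial>M"
  shows "integrable M (\<lambda>\<omega>. gap (X \<omega> - h *\<^sub>R G (X \<omega>) (Z \<omega>)))"
    and "(\<integral>\<omega>. gap (X \<omega> - h *\<^sub>R G (X \<omega>) (Z \<omega>)) \<partial>M)
           \<le> m - \<mu> * h * m powr (2 / \<alpha>) + L * A * h\<^sup>2 * m powr \<beta> + L * C / (2 * b) * h\<^sup>2"
proof -
  interpret M: prob_space M by fact
  interpret D: prob_space D by fact
  have [measurable]: "(\<lambda>(x, s). G x s) \<in> borel_measurable (borel \<Otimes>\<^sub>M D)"
    using es unfolding expected_smoothness_def by blast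
  define q where "q x = gap x - \<mu> * h * gap x powr (2 / \<alpha>) + L * A * h\<^sup>2 * gap x powr \<beta>
    + L * C / (2 * b) * h\<^sup>2" for x
  define \<Phi> where "\<Phi> = (\<lambda>(x, s). gap (x - h *\<^sub>R G x s))"
  have \<Phi>_meas [measurable]: "\<Phi> \<in> borel_measurable (borel \<Otimes>\<^sub>M D)"
    unfolding \<Phi>_def by measurable
  have \<Phi>_nonneg: "0 \<le> \<Phi> z" for z
    unfolding \<Phi>_def by (auto simp: gap_nonneg split: prod.split)
  have step: "integrable D (\<lambda>s. \<Phi> (x, s))" "(\<integral>s. \<Phi> (x, s) \<partial>D) \<le> q x" for x
    using expected_gap_step_le[OF D es h, of x] by (simp_all add: \<Phi>_def q_def)
  have q_nonneg: "0 \<le> q x" for x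
    by (rule order_trans[OF Bochner_Integration.integral_nonneg step(2)]) (rule \<Phi>_nonneg)
  note gb = M.expectation_powr_le[OF X_int gap_nonneg beta]
  note ga = gap_powr_integrable[OF X_int]
  have q_int: "integrable M (\<lambda>\<omega>. q (X \<omega>))"
    unfolding q_def using X_int ga gb(1) by auto
  \<comment> \<open>Integrability of the new gap is still open, so the estimate runs through
    nonnegative integrals; their finiteness then supplies it.\<close>
  have "(\<integral>\<^sup>+\<omega>. \<Phi> (X \<omega>, Z \<omega>) \<partial>M) = (\<integral>\<^sup>+z. \<Phi> z \<partial>distr M (borel \<Otimes>\<^sub>M D) (\<lambda>\<omega>. (X \<omega>, Z \<omega>)))"
    by (subst nn_integral_distr) auto
  also have "\<dots> = (\<integral>\<^sup>+x. \<integral>\<^sup>+s. \<Phi> (x, s) \<partial>D \<partial>distr M borel X)"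
    unfolding joint by (subst D.nn_integral_fst[symmetric]) auto
  also have "\<dots> = (\<integral>\<^sup>+\<omega>. \<integral>\<^sup>+s. \<Phi> (X \<omega>, s) \<partial>D \<partial>M)"
    by (subst nn_integral_distr) auto
  also have "\<dots> = (\<integral>\<^sup>+\<omega>. ennreal (\<integral>s. \<Phi> (X \<omega>, s) \<partial>D) \<partial>M)"
    using step(1) \<Phi>_nonneg by (subst nn_integral_eq_integral) auto
  also have "\<dots> \<le> (\<integral>\<^sup>+\<omega>. ennreal (q (X \<omega>)) \<partial>M)"
    using step(2) by (intro nn_integral_mono ennreal_leI) auto
  also have "\<dots> = ennreal (\<integral>\<omega>. q (X \<omega>) \<partial>M)"
    using q_int q_nonneg by (intro nn_integral_eq_integral) auto
  finally have nn: "(\<integral>\<^sup>+\<omega>. \<Phi> (X \<omega>, Z \<omega>) \<partial>M) \<le> ennreal (\<integral>\<omega>. q (X \<omega>) \<partial>M)" .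
  have int: "integrable M (\<lambda>\<omega>. \<Phi> (X \<omega>, Z \<omega>))"
    using nn \<Phi>_nonneg by (intro integrableI_nonneg) (auto simp: less_top[symmetric] top_unique)
  then show "integrable M (\<lambda>\<omega>. gap (X \<omega> - h *\<^sub>R G (X \<omega>) (Z \<omega>)))"
    by (simp add: \<Phi>_def)
  have "ennreal (\<integral>\<omega>. \<Phi> (X \<omega>, Z \<omega>) \<partial>M) \<le> ennreal (\<integral>\<omega>. q (X \<omega>) \<partial>M)"
    using nn nn_integral_eq_integral[OF int] \<Phi>_nonneg by simp
  then have "(\<integral>\<omega>. \<Phi> (X \<omega>, Z \<omega>) \<partial>M) \<le> (\<integral>\<omega>. q (X \<omega>) \<partial>M)"
    using q_nonneg by (simp add: Bochner_Integration.integral_nonneg)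
  also have "\<dots> = m - \<mu> * h * (\<integral>\<omega>. gap (X \<omega>) powr (2 / \<alpha>) \<partial>M)
      + L * A * h\<^sup>2 * (\<integral>\<omega>. gap (X \<omega>) powr \<beta> \<partial>M) + L * C / (2 * b) * h\<^sup>2"
    unfolding q_def m_def using X_int ga gb(1) by (simp add: M.prob_space)
  also have "\<dots> \<le> m - \<mu> * h * m powr (2 / \<alpha>) + L * A * h\<^sup>2 * m powr \<beta> + L * C / (2 * b) * h\<^sup>2"
    unfolding m_def using gb(2) A L_pos h mu alpha_bounds gap_nonneg X_int ga
    by (intro add_right_mono add_mono diff_left_mono mult_left_mono M.expectation_powr_ge) auto
  finally show "(\<integral>\<omega>. gap (X \<omega> - h *\<^sub>R G (X \<omega>) (Z \<omega>)) \<partial>M)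
           \<le> m - \<mu> * h * m powr (2 / \<alpha>) + L * A * h\<^sup>2 * m powr \<beta> + L * C / (2 * b) * h\<^sup>2"
    by (simp add: \<Phi>_def)
qed

end

subsection \<open>Independence of the iterate and the next sample\<close>

text \<open>The iterate reads only samples of outer iterations before \<open>k\<close>; its
  independence of the samples of iteration \<open>k\<close> rests on this.\<close>

lemma sgd_restarts_cong:
  assumes "\<And>j t. j < k \<Longrightarrow> s j t = s' j t"
  shows "sgd_restarts g \<eta> s T k x = sgd_restarts g \<eta> s' T k x"
  using assms
proof (induction k)
  case (Suc k)
  have "sgd_inner (g k) (\<eta> k) (s k) t y = sgd_inner (g k) (\<eta> k) (s' k) t y" for t y
    using Suc.prems by (induction t) (auto simp: Let_def)
  then show ?case
    using Suc by simp
qed simp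

lemma measurable_sgd_inner:
  fixes G :: "'a::euclidean_space \<Rightarrow> 's \<Rightarrow> 'a"
  assumes G [measurable]: "(\<lambda>(x, s). G x s) \<in> borel_measurable (borel \<Otimes>\<^sub>M D)"
    and X: "X \<in> borel_measurable N" and s [measurable]: "\<And>t. (\<lambda>\<omega>. s \<omega> t) \<in> N \<rightarrow>\<^sub>M D"
  shows "(\<lambda>\<omega>. sgd_inner G h (s \<omega>) T (X \<omega>)) \<in> borel_measurable N"
proof (induction T)
  case (Suc T)
  note [measurable] = this
  have "(\<lambda>\<omega>. (sgd_inner G h (s \<omega>) T (X \<omega>), s \<omega> T)) \<in> N \<rightarrow>\<^sub>M borel \<Otimes>\<^sub>M D"
    by measurable
  from measurable_compose[OF this G] show ?case
    by (simp add: Let_def)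
qed (use X in simp)

text \<open>The index set \<open>I\<close> is left general so that the iterate can be viewed as a
  function on the product of the earlier samples alone.\<close>

lemma measurable_sgd_restarts:
  fixes g :: "nat \<Rightarrow> 'a::euclidean_space \<Rightarrow> 's \<Rightarrow> 'a"
  assumes "\<And>k. (\<lambda>(x, s). g k x s) \<in> borel_measurable (borel \<Otimes>\<^sub>M D)"
    and "{..<k} \<times> UNIV \<subseteq> I"
  shows "(\<lambda>z. sgd_restarts g \<eta> (curry z) T k x) \<in> borel_measurable (Pi\<^sub>M I (\<lambda>_. D))"
  using assms(2)
proof (induction k)
  case (Suc k)
  then have "{..<k} \<times> UNIV \<subseteq> I"
    by auto
  with Suc have "(\<lambda>z. sgd_restarts g \<eta> (curry z) T k x) \<in> borel_measurable (Pi\<^sub>M I (\<lambda>_. D))"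
    by blast
  moreover have "(\<lambda>z. curry z k t) \<in> Pi\<^sub>M I (\<lambda>_. D) \<rightarrow>\<^sub>M D" for t
    using Suc.prems unfolding curry_def by (intro measurable_component_singleton) auto
  ultimately show ?case
    unfolding sgd_restarts.simps by (rule measurable_sgd_inner[OF assms(1)])
qed simp

text \<open>The iterate is a measurable function of the samples in the rows before \<open>k\<close>,
  and \<open>(k, t)\<close> lies outside these rows. Disjoint blocks of an independent family are
  independent, and their product law is pushed forward to the pair.\<close>

lemma (in prob_space) distr_sgd_restarts_sample:
  fixes g :: "nat \<Rightarrow> 'b::euclidean_space \<Rightarrow> 's \<Rightarrow> 'b" and x :: 'b and \<eta> :: "nat \<Rightarrow> real" and T k t :: nat
  assumes g: "\<And>k. (\<lambda>(x, s). g k x s) \<in> borel_measurable (borel \<Otimes>\<^sub>M D)"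
    and indep: "indep_vars (\<lambda>_. D) (\<lambda>(k, t). \<xi> k t) UNIV"
  defines "X \<equiv> \<lambda>k \<omega>. sgd_restarts g \<eta> (\<lambda>k t. \<xi> k t \<omega>) T k x"
  shows "\<xi> k t \<in> M \<rightarrow>\<^sub>M D" and "X k \<in> borel_measurable M"
    and "distr M (borel \<Otimes>\<^sub>M D) (\<lambda>\<omega>. (X k \<omega>, \<xi> k t \<omega>)) = distr M borel (X k) \<Otimes>\<^sub>M distr M D (\<xi> k t)"
proof -
  define I where "I = {..<k} \<times> (UNIV :: nat set)"
  define Y where "Y J \<omega> = restrict (\<lambda>i. (case i of (k, t) \<Rightarrow> \<xi> k t) \<omega>) J" for J \<omega>
  define F where "F z = sgd_restarts g \<eta> (curry z) T k x" for z
  let ?I = "Pi\<^sub>M I (\<lambda>_. D)" and ?J = "Pi\<^sub>M {(k, t)} (\<lambda>_. D)"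
  have "indep_var ?I (Y I) ?J (Y {(k, t)})"
    unfolding Y_def by (rule indep_var_restrict[OF indep]) (auto simp: I_def)
  then have Y [measurable]: "Y I \<in> M \<rightarrow>\<^sub>M ?I" "Y {(k, t)} \<in> M \<rightarrow>\<^sub>M ?J"
    and Y_joint: "distr M ?I (Y I) \<Otimes>\<^sub>M distr M ?J (Y {(k, t)})
      = distr M (?I \<Otimes>\<^sub>M ?J) (\<lambda>\<omega>. (Y I \<omega>, Y {(k, t)} \<omega>))"
    unfolding indep_var_distribution_eq by auto
  have F [measurable]: "F \<in> borel_measurable ?I"
    unfolding F_def using g by (rule measurable_sgd_restarts) (simp add: I_def)
  have ev [measurable]: "(\<lambda>z. z (k, t)) \<in> ?J \<rightarrow>\<^sub>M D"
    by (rule measurable_component_singleton) simp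
  \<comment> \<open>Outside \<open>I\<close> the restricted family is \<open>undefined\<close>, but
    the iterate never reads it there.\<close>
  have X_eq: "X k = (\<lambda>\<omega>. F (Y I \<omega>))"
    unfolding X_def F_def Y_def by (intro ext sgd_restarts_cong) (simp add: I_def)
  have \<xi>_eq: "\<xi> k t = (\<lambda>\<omega>. Y {(k, t)} \<omega> (k, t))"
    by (simp add: Y_def)
  show X_meas: "X k \<in> borel_measurable M" and \<xi>_meas: "\<xi> k t \<in> M \<rightarrow>\<^sub>M D"
    using measurable_compose[OF Y(1) F] measurable_compose[OF Y(2) ev]
    by (simp_all add: X_eq \<xi>_eq[symmetric])
  interpret \<xi>: prob_space "distr M D (\<xi> k t)"
    by (rule prob_space_distr) fact
  have "distr M borel (X k) \<Otimes>\<^sub>M distr M D (\<xi> k t)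
      = distr (distr M ?I (Y I)) borel F \<Otimes>\<^sub>M distr (distr M ?J (Y {(k, t)})) D (\<lambda>z. z (k, t))"
    by (simp add: distr_distr comp_def X_eq \<xi>_eq[symmetric])
  also have "\<dots> = distr (distr M ?I (Y I) \<Otimes>\<^sub>M distr M ?J (Y {(k, t)})) (borel \<Otimes>\<^sub>M D)
      (\<lambda>(z, w). (F z, w (k, t)))"
  proof (rule pair_measure_distr)
    show "sigma_finite_measure (distr (distr M ?J (Y {(k, t)})) D (\<lambda>z. z (k, t)))"
      using \<xi>.sigma_finite_measure_axioms by (simp add: distr_distr comp_def \<xi>_eq[symmetric])
  qed auto
  also have "\<dots> = distr M (borel \<Otimes>\<^sub>M D) (\<lambda>\<omega>. (X k \<omega>, \<xi> k t \<omega>))"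
    unfolding Y_joint by (subst distr_distr) (auto simp: comp_def X_eq fun_cong[OF \<xi>_eq, symmetric])
  finally show "distr M (borel \<Otimes>\<^sub>M D) (\<lambda>\<omega>. (X k \<omega>, \<xi> k t \<omega>))
      = distr M borel (X k) \<Otimes>\<^sub>M distr M D (\<xi> k t)" ..
qed

subsection \<open>The scalar recursion\<close>

text \<open>Bernoulli's inequality for the exponent \<open>- r\<close>, from
  \<open>ln (1 + 1 / n) \<le> 1 / n\<close> and \<open>1 + z \<le> exp z\<close>. It limits the
  relative decrement of the target rate to \<open>r / n\<close>.\<close>

lemma powr_minus_Suc_ge:
  fixes n r :: real
  assumes "0 < n" "0 \<le> r"
  shows "n powr - r * (1 - r / n) \<le> (n + 1) powr - r"
proof -
  have "1 - r / n \<le> 1 + (- r * ln (1 + 1 / n))"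
    using ln_add_one_self_le_self[of "1 / n"] mult_left_mono[of "ln (1 + 1 / n)" "1 / n" r] assms by simp
  also have "\<dots> \<le> (1 + 1 / n) powr - r"
    using exp_ge_add_one_self[of "- r * ln (1 + 1 / n)"] add_pos_pos[of 1 "1 / n"] assms
    by (simp add: powr_def)
  finally have "n powr - r * (1 - r / n) \<le> n powr - r * (1 + 1 / n) powr - r"
    by (intro mult_left_mono) auto
  also have "\<dots> = (n + 1) powr - r"
    using assms by (subst powr_mult[symmetric]) (auto simp: distrib_left)
  finally show ?thesis .
qed

text \<open>One induction step: \<open>u\<close> and \<open>u'\<close> are the present and the next
  bound, \<open>q\<close> the allowed decrement, \<open>e\<close> the noise. If \<open>d\<close> is
  at least \<open>u / 2\<close>, the contraction pays for \<open>q + e\<close>; otherwise the slack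
  \<open>u / 2\<close> does, unless \<open>u\<close> is too large.\<close>

lemma recursion_step:
  fixes u u' d d' h \<mu> L \<theta> q e :: real
  assumes th: "1 \<le> \<theta>" "\<theta> \<le> 2" and mu: "0 < \<mu>" and L: "0 < L" and h: "0 < h" "L * h \<le> 1"
    and u: "0 < u" and u': "u - q \<le> u'" and q: "q \<le> u / 2"
    and d: "0 \<le> d" "d \<le> u" and d': "\<mu> * d' powr \<theta> \<le> L * d'"
    and rec: "d' \<le> d - \<mu> * h * d powr \<theta> + e"
    and noise: "q + e \<le> \<mu> * h * u powr \<theta> / 4"
  shows "d' \<le> u'"
proof (cases "u / 2 \<le> d")
  case True
  \<comment> \<open>As \<open>\<theta> \<le> 2\<close>, halving \<open>u\<close> costs at most the
    factor 4 that stands in \<open>noise\<close>.\<close>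
  have "2 powr \<theta> \<le> (2::real) powr 2"
    using th by (intro powr_mono) auto
  then have "u powr \<theta> / 4 \<le> u powr \<theta> / 2 powr \<theta>"
    by (intro divide_left_mono) auto
  also have "\<dots> = (u / 2) powr \<theta>"
    using u by (simp add: powr_divide)
  also have "\<dots> \<le> d powr \<theta>"
    using True u th by (intro powr_mono2) auto
  finally have "\<mu> * h * (u powr \<theta> / 4) \<le> \<mu> * h * d powr \<theta>"
    using mu h by (intro mult_left_mono) auto
  then show ?thesis
    using rec noise u' d by simp
next
  case False
  have "0 \<le> \<mu> * h * d powr \<theta>"
    using mu h by simp
  then have d'_le: "d' \<le> u / 2 + e"
    using False rec by linarith
  show ?thesis
  proof (cases "\<mu> * h * u powr \<theta> \<le> 2 * u")
    case True
    \<comment> \<open>Here \<open>noise\<close> gives \<open>q + e \<le> u / 2\<close>.\<close>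
    then show ?thesis
      using d'_le noise u' by linarith
  next
    case big: False
    \<comment> \<open>Here \<open>u\<close> exceeds the a priori bound that \<open>\<mu> d'\<^sup>\<theta> \<le> L d'\<close> puts on \<open>d'\<close>.\<close>
    show ?thesis
    proof (rule ccontr)
      assume "\<not> d' \<le> u'"
      then have less: "u / 2 < d'"
        using u' q by linarith
      have split: "t powr \<theta> = t * t powr (\<theta> - 1)" if "0 < t" for t :: real
        using that powr_add[of t 1 "\<theta> - 1"] by simp
      have "d' * (\<mu> * d' powr (\<theta> - 1)) \<le> d' * L"
        using d' less u by (simp add: split mult_ac)
      then have "\<mu> * d' powr (\<theta> - 1) \<le> L"
        using less u by simp
      have "(2::real) powr (\<theta> - 1) \<le> 2 powr 1"
        using th by (intro powr_mono) auto
      then have "u powr (\<theta> - 1) / 2 \<le> u powr (\<theta> - 1) / 2 powr (\<theta> - 1)"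
        by (intro divide_left_mono) auto
      also have "\<dots> = (u / 2) powr (\<theta> - 1)"
        using u by (simp add: powr_divide)
      also have "\<dots> \<le> d' powr (\<theta> - 1)"
        using less u th by (intro powr_mono2) auto
      finally have "\<mu> * h * u powr (\<theta> - 1) \<le> 2 * h * (\<mu> * d' powr (\<theta> - 1))"
        using mu h mult_left_mono[of "u powr (\<theta> - 1) / 2" "d' powr (\<theta> - 1)" "2 * h * \<mu>"]
        by (simp add: mult_ac)
      also have "\<dots> \<le> 2 * h * L"
        using \<open>\<mu> * d' powr (\<theta> - 1) \<le> L\<close> h by (intro mult_left_mono) auto
      also have "\<dots> \<le> 2"
        using h by (simp add: mult_ac)
      finally have "\<mu> * h * u powr (\<theta> - 1) * u \<le> 2 * u"
        using u by (intro mult_right_mono) auto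
      then show False
        using big u by (simp add: split mult_ac)
    qed
  qed
qed

text \<open>Induction on \<open>k\<close> with \<open>recursion_step\<close>. The decrement and the
  two noise terms each receive a twelfth of \<open>\<mu> * \<eta> k * u powr \<theta>\<close>,
  together the quarter required there. Only \<open>R\<close> depends on \<open>d 0\<close>.\<close>

lemma recursion_rate:
  fixes d w \<eta> :: "nat \<Rightarrow> real" and \<theta> \<beta> \<mu> L a W \<tau> r p c N :: real
  assumes th: "1 \<le> \<theta>" "\<theta> \<le> 2" and beta: "\<beta> \<le> 1" and mu: "0 < \<mu>" and L: "0 < L"
    and a: "0 \<le> a" and W: "0 \<le> W" and r: "0 < r" and c: "12 * r / \<mu> \<le> c" and N: "1 \<le> N" "2 * r \<le> N"
    and \<eta>: "\<And>k. \<eta> k = c * (real k + N) powr - p"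
    and small: "\<And>k. L * \<eta> k \<le> 1" "\<And>k. \<theta> = \<beta> \<Longrightarrow> a * \<eta> k \<le> \<mu> / 12"
    and d: "\<And>k. 0 \<le> d k" "\<And>k. \<mu> * d k powr \<theta> \<le> L * d k"
    and rec: "\<And>k. d (Suc k) \<le> d k - \<mu> * \<eta> k * d k powr \<theta> + a * (\<eta> k)\<^sup>2 * d k powr \<beta> + w k * (\<eta> k)\<^sup>2"
    and w: "\<And>k. w k \<le> W * (real k + N) powr - \<tau>"
    and exps: "p + r * \<theta> = r + 1" "r + 1 \<le> 2 * p + r * \<beta>" "r + 1 \<le> 2 * p + \<tau>" and beta0: "0 \<le> \<beta>"
  obtains R where "0 < R" "\<And>k. d k \<le> R * (real k + N) powr - r"
proof -
  have c0: "0 < c"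
    using c r mu by (meson divide_pos_pos less_le_trans mult_pos_pos zero_less_numeral)
  \<comment> \<open>The entries give \<open>R \<le> R powr \<theta>\<close>, absorb the
    \<open>W\<close> noise and the \<open>a\<close> noise, and start the induction. If
    \<open>\<theta> = \<beta>\<close>, the exponent \<open>1 / 0\<close> is 0 and the third entry is
    at most 1.\<close>
  define R where "R = Max {1, 12 * W * c / \<mu>, (12 * a * c / \<mu>) powr (1 / (\<theta> - \<beta>)), d 0 * N powr r}"
  have R: "1 \<le> R" "12 * W * c / \<mu> \<le> R" "(12 * a * c / \<mu>) powr (1 / (\<theta> - \<beta>)) \<le> R" "d 0 * N powr r \<le> R"
    unfolding R_def by (auto intro!: Max_ge)
  have R\<theta>: "R \<le> R powr \<theta>"
    using powr_mono[of 1 \<theta> R] R(1) th by simp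
  have RA: "12 * a * c / \<mu> * R powr \<beta> \<le> R powr \<theta>" if "\<beta> < \<theta>"
  proof -
    have "12 * a * c / \<mu> = ((12 * a * c / \<mu>) powr (1 / (\<theta> - \<beta>))) powr (\<theta> - \<beta>)"
      using that a c0 mu by (simp add: powr_powr)
    also have "\<dots> \<le> R powr (\<theta> - \<beta>)"
      using that R(3) by (intro powr_mono2) auto
    finally have "12 * a * c / \<mu> * R powr \<beta> \<le> R powr (\<theta> - \<beta>) * R powr \<beta>"
      by (rule mult_right_mono) simp
    then show ?thesis
      by (simp add: powr_add[symmetric])
  qed
  have "d k \<le> R * (real k + N) powr - r" for k
  proof (induction k)
    case 0
    then show ?case
      using R(4) N by (simp add: powr_minus field_simps)
  next
    case (Suc k)
    define n where "n = real k + N"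
    define u where "u = R * n powr - r"
    define E where "E = n powr - (r + 1)"
    have n: "1 \<le> n" "2 * r \<le> n"
      using N by (auto simp: n_def)
    have u0: "0 < u"
      using R n by (simp add: u_def)
    have \<eta>0: "0 < \<eta> k"
      using c0 n by (simp add: \<eta> n_def)
    have \<eta>n: "\<eta> k = c * n powr - p"
      by (simp add: \<eta> n_def)
    have u_powr: "u powr z = R powr z * n powr - (r * z)" for z
      unfolding u_def using R n by (simp add: powr_mult powr_powr)
    \<comment> \<open>The equation in \<open>exps\<close> gives the contraction exactly the order
      \<open>E\<close> of the decrement.\<close>
    have main: "\<eta> k * u powr \<theta> = c * R powr \<theta> * E"
    proof -
      have "- p - r * \<theta> = - r - 1"
        using exps(1) by linarith
      then show ?thesis
        by (simp add: \<eta>n u_powr E_def powr_add[symmetric])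
    qed
    have E: "0 < E"
      using n by (simp add: E_def)
    have \<eta>2: "(\<eta> k)\<^sup>2 = c\<^sup>2 * n powr - (2 * p)"
      by (simp add: \<eta>n power_mult_distrib power2_eq_square powr_add[symmetric])
    have T1: "r / n * u \<le> \<mu> * \<eta> k * u powr \<theta> / 12"
    proof -
      have "r / n * u = r * R * E"
        using n by (simp add: u_def E_def powr_diff powr_minus field_simps)
      also have "\<dots> \<le> (\<mu> * c / 12) * R powr \<theta> * E"
        using c c0 mu r R R\<theta> E by (intro mult_mono) (auto simp: field_simps)
      finally show ?thesis
        using main by (simp add: mult_ac)
    qed
    have T2: "a * (\<eta> k)\<^sup>2 * u powr \<beta> \<le> \<mu> * \<eta> k * u powr \<theta> / 12"
    proof (cases "\<theta> = \<beta>")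
      \<comment> \<open>Both sides scale alike in \<open>R\<close>, so enlarging \<open>R\<close> is
        no help; smallness of the step-size decides.\<close>
      case True
      have "a * \<eta> k * (\<eta> k * u powr \<beta>) \<le> \<mu> / 12 * (\<eta> k * u powr \<beta>)"
        using small(2)[OF True] \<eta>0 by (intro mult_right_mono) auto
      then show ?thesis
        using True by (simp add: power2_eq_square mult_ac)
    next
      case False
      have "a * (\<eta> k)\<^sup>2 * u powr \<beta> = a * c\<^sup>2 * R powr \<beta> * n powr - (2 * p + r * \<beta>)"
        by (simp add: \<eta>2 u_powr powr_add[symmetric])
      also have "\<dots> \<le> a * c\<^sup>2 * R powr \<beta> * E"
        unfolding E_def using exps(2) a n by (intro mult_left_mono powr_mono) auto
      also have "\<dots> = (12 * a * c / \<mu> * R powr \<beta>) * (\<mu> * c * E / 12)"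
        using mu by (simp add: power2_eq_square)
      also have "\<dots> \<le> R powr \<theta> * (\<mu> * c * E / 12)"
        using False th beta mu c0 E by (intro mult_right_mono RA) auto
      finally show ?thesis
        using main by (simp add: mult_ac)
    qed
    have T3: "w k * (\<eta> k)\<^sup>2 \<le> \<mu> * \<eta> k * u powr \<theta> / 12"
    proof -
      have "w k * (\<eta> k)\<^sup>2 \<le> W * n powr - \<tau> * (\<eta> k)\<^sup>2"
        using w[of k] by (intro mult_right_mono) (auto simp: n_def)
      also have "\<dots> = W * c\<^sup>2 * n powr - (\<tau> + 2 * p)"
        by (simp add: \<eta>2 powr_add[symmetric])
      also have "\<dots> \<le> W * c\<^sup>2 * E"
        unfolding E_def using exps(3) W n by (intro mult_left_mono powr_mono) auto
      also have "\<dots> = (12 * W * c / \<mu>) * (\<mu> * c * E / 12)"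
        using mu by (simp add: power2_eq_square)
      also have "\<dots> \<le> R powr \<theta> * (\<mu> * c * E / 12)"
        using R R\<theta> mu c0 E by (intro mult_right_mono) auto
      finally show ?thesis
        using main by (simp add: mult_ac)
    qed
    have "d (Suc k) \<le> R * (n + 1) powr - r"
    proof (rule recursion_step[OF th mu L \<eta>0 small(1) u0])
      show "u - r / n * u \<le> R * (n + 1) powr - r"
        using powr_minus_Suc_ge[of n r] n r R mult_left_mono[of "n powr - r * (1 - r / n)" "(n + 1) powr - r" R]
        by (simp add: u_def algebra_simps)
      show "r / n * u \<le> u / 2"
        using n u0 by (simp add: field_simps)
      show "d k \<le> u"
        using Suc by (simp add: u_def n_def)
      \<comment> \<open>The state-dependent noise is replaced by its value at \<open>u\<close>, so
        that \<open>e\<close> is free of \<open>d k\<close>.\<close>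
      show "d (Suc k) \<le> d k - \<mu> * \<eta> k * d k powr \<theta> + (a * (\<eta> k)\<^sup>2 * u powr \<beta> + w k * (\<eta> k)\<^sup>2)"
        using rec[of k] mult_left_mono[OF powr_mono2[OF beta0 d(1) \<open>d k \<le> u\<close>], of "a * (\<eta> k)\<^sup>2"] a by simp
      show "r / n * u + (a * (\<eta> k)\<^sup>2 * u powr \<beta> + w k * (\<eta> k)\<^sup>2) \<le> \<mu> * \<eta> k * u powr \<theta> / 4"
        using T1 T2 T3 by linarith
    qed (use d in auto)
    then show ?case
      by (simp add: n_def add_ac)
  qed
  then show ?thesis
    using R(1) that[of R] by auto
qed

subsection \<open>Rates and cost\<close>

text \<open>The finitely many exceptional indices are absorbed by enlarging the constant, which is
  possible because \<open>g\<close> is positive.\<close>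

lemma bigo_sequentially_imp_bound:
  fixes f g :: "nat \<Rightarrow> real"
  assumes "f \<in> O(g)" and g: "\<And>k. 0 < g k"
  obtains c where "0 < c" "\<And>k. f k \<le> c * g k"
proof -
  from assms(1) obtain c where c: "0 < c" "\<forall>\<^sub>F k in sequentially. norm (f k) \<le> c * norm (g k)"
    by (rule landau_o.bigE)
  then obtain n where n: "\<And>k. n \<le> k \<Longrightarrow> norm (f k) \<le> c * norm (g k)"
    by (auto simp: eventually_sequentially)
  define c' where "c' = Max (insert c ((\<lambda>k. f k / g k) ` {..n}))"
  have "f k \<le> c' * g k" for k
  proof (cases "k \<le> n")
    case True
    then have "f k / g k \<le> c'"
      unfolding c'_def by (intro Max_ge) auto
    then show ?thesis
      using g[of k] by (simp add: field_simps)
  next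
    case False
    have "f k \<le> c * g k"
      using n[of k] False g[of k] by simp
    also have "\<dots> \<le> c' * g k"
      using g[of k] by (intro mult_right_mono) (auto simp: c'_def)
    finally show ?thesis .
  qed
  moreover have "c \<le> c'"
    by (simp add: c'_def)
  ultimately show ?thesis
    using that[of c'] c by simp
qed

text \<open>Allows step-sizes in \<open>k + N\<close>, positive at \<open>k = 0\<close> and
  uniformly small for large \<open>N\<close>, without changing their order.\<close>

lemma bigtheta_shift_powr:
  assumes "0 \<le> N"
  shows "(\<lambda>k. (real k + N) powr z) \<in> \<Theta>(\<lambda>k. real k powr z)"
proof -
  have "(\<lambda>k. real k + N) \<in> \<Theta>(\<lambda>k. real k)"
  proof (rule bigthetaI'[of 1 "1 + N"])
    show "\<forall>\<^sub>F k in sequentially. 1 * norm (real k) \<le> norm (real k + N) \<and> norm (real k + N) \<le> (1 + N) * norm (real k)"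
      using eventually_ge_at_top[of "1::nat"]
    proof eventually_elim
      case (elim k)
      then have "N * 1 \<le> N * real k"
        using assms by (intro mult_left_mono) auto
      then show ?case
        using assms by (simp add: algebra_simps)
    qed
  qed (use assms in auto)
  from bigtheta_powr[OF this, of z] show ?thesis
    using assms by simp
qed

text \<open>\<open>K \<epsilon>\<close> is the first index at which \<open>R * K powr - r\<close> is
  at most \<open>\<epsilon>\<close>. For \<open>\<epsilon> < R\<close> rounding up at most doubles
  it, and the cost is at most \<open>K\<close> times its largest term bound.\<close>

lemma rate_imp_cost:
  fixes b :: "nat \<Rightarrow> real"
  assumes r: "0 < r" and R: "0 < R" and tau: "0 \<le> \<tau>" and b0: "\<And>k. 0 \<le> b k"
    and b: "\<And>k. b k \<le> H * (real k + 1) powr \<tau>" and H: "0 < H"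
  defines "K \<equiv> \<lambda>\<epsilon>. nat \<lceil>(R / \<epsilon>) powr (1 / r)\<rceil>"
  shows "(\<lambda>\<epsilon>. \<Sum>k<K \<epsilon>. b k) \<in> O[at_right 0](\<lambda>\<epsilon>. \<epsilon> powr - ((\<tau> + 1) / r))"
    and "\<And>\<epsilon> N. 0 < \<epsilon> \<Longrightarrow> 0 < N \<Longrightarrow> R * (real (K \<epsilon>) + N) powr - r \<le> \<epsilon>"
proof -
  show "(\<lambda>\<epsilon>. \<Sum>k<K \<epsilon>. b k) \<in> O[at_right 0](\<lambda>\<epsilon>. \<epsilon> powr - ((\<tau> + 1) / r))"
  proof (rule bigoI)
    show "\<forall>\<^sub>F \<epsilon> in at_right 0. norm (\<Sum>k<K \<epsilon>. b k)
        \<le> (H * 2 powr (\<tau> + 1) * R powr ((\<tau> + 1) / r)) * norm (\<epsilon> powr - ((\<tau> + 1) / r))"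
      using eventually_at_right_real[OF R]
    proof eventually_elim
      case (elim \<epsilon>)
      define y where "y = (R / \<epsilon>) powr (1 / r)"
      have y: "1 \<le> y"
        unfolding y_def using elim r by (intro ge_one_powr_ge_zero) auto
      have K: "real (K \<epsilon>) \<le> 2 * y"
        using y of_int_ceiling_le_add_one[of y] unfolding K_def y_def[symmetric] by linarith
      have "(\<Sum>k<K \<epsilon>. b k) \<le> (\<Sum>k<K \<epsilon>. H * (2 * y) powr \<tau>)"
      proof (rule sum_mono)
        fix k assume "k \<in> {..<K \<epsilon>}"
        then have "real k + 1 \<le> 2 * y"
          using K by auto
        then show "b k \<le> H * (2 * y) powr \<tau>"
          using H tau by (intro order_trans[OF b] mult_left_mono powr_mono2) auto
      qed
      also have "\<dots> = real (K \<epsilon>) * (H * (2 * y) powr \<tau>)"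
        by simp
      also have "\<dots> \<le> (2 * y) * (H * (2 * y) powr \<tau>)"
        using K H by (intro mult_right_mono) auto
      also have "\<dots> = H * (2 * y) powr (\<tau> + 1)"
        using y by (simp add: powr_add)
      also have "\<dots> = H * 2 powr (\<tau> + 1) * R powr ((\<tau> + 1) / r) * \<epsilon> powr - ((\<tau> + 1) / r)"
        using y elim R by (simp add: powr_mult y_def powr_powr powr_divide powr_minus field_simps)
      finally show ?case
        using b0 by (simp add: sum_nonneg)
    qed
  qed
  fix \<epsilon> N :: real
  assume \<epsilon>: "0 < \<epsilon>" and N: "0 < N"
  have "(R / \<epsilon>) powr (1 / r) \<le> real (K \<epsilon>) + N"
    unfolding K_def using N real_nat_ceiling_ge[of "(R / \<epsilon>) powr (1 / r)"] by linarith
  then have "(real (K \<epsilon>) + N) powr - r \<le> ((R / \<epsilon>) powr (1 / r)) powr - r"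
    using r R \<epsilon> by (intro powr_mono2') auto
  also have "\<dots> = \<epsilon> / R"
    using r R \<epsilon> by (simp add: powr_powr powr_minus)
  finally show "R * (real (K \<epsilon>) + N) powr - r \<le> \<epsilon>"
    using R by (simp add: field_simps)
qed

text \<open>Below the threshold \<open>p\<close> and \<open>r\<close> solve the equation together
  with \<open>2 * p + \<tau> = r + 1\<close>, above it together with
  \<open>2 * p + r * \<beta> = r + 1\<close>. The threshold is where the remaining inequality
  becomes tight.\<close>

lemma rate_exponents:
  fixes \<alpha> \<beta> \<tau> :: real
  assumes alpha: "1 \<le> \<alpha>" "\<alpha> \<le> 2" and beta: "0 < \<beta>" "\<beta> \<le> 1" and tau: "0 \<le> \<tau>"
  obtains p r where "0 < p" "0 < r" "step_exponent \<alpha> (\<alpha> * \<beta>) \<tau> = - p"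
    "cost_exponent \<alpha> (\<alpha> * \<beta>) \<tau> = - ((\<tau> + 1) / r)"
    "p + r * (2 / \<alpha>) = r + 1" "r + 1 \<le> 2 * p + r * \<beta>" "r + 1 \<le> 2 * p + \<tau>"
proof -
  define \<gamma> where "\<gamma> = \<alpha> * \<beta>"
  have \<gamma>: "0 < \<gamma>" "\<gamma> \<le> \<alpha>"
    using alpha beta by (auto simp: \<gamma>_def intro: mult_left_le)
  have \<beta>_eq: "\<beta> = \<gamma> / \<alpha>"
    using alpha by (simp add: \<gamma>_def)
  show ?thesis
  proof (cases "\<gamma> = 2")
    case True
    then have "\<alpha> = 2" "\<beta> = 1"
      using alpha \<gamma> \<beta>_eq by auto
    then show ?thesis
      using tau by (intro that[of 1 "\<tau> + 1"]) (auto simp: step_exponent_def cost_exponent_def tau_threshold_def)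
  next
    case False
    then have g2: "\<gamma> < 2"
      using \<gamma> alpha by linarith
    then have den: "0 < 4 - \<alpha> - \<gamma>" "0 < 4 - \<alpha>"
      using alpha \<gamma> by auto
    show ?thesis
    proof (cases "\<tau> \<le> \<gamma> / (4 - \<alpha> - \<gamma>)")
      case True
      then have t: "\<tau> * (4 - \<alpha> - \<gamma>) \<le> \<gamma>"
        using den by (simp add: pos_le_divide_eq)
      define p r where "p = (\<tau> + 1) / (2 - \<alpha> / 2) - \<tau>" and "r = \<alpha> * (\<tau> + 1) / (4 - \<alpha>)"
      have p_eq: "p = (2 - \<tau> * (2 - \<alpha>)) / (4 - \<alpha>)"
        using den by (simp add: p_def divide_simps) (simp add: algebra_simps)
      \<comment> \<open>Positivity of \<open>p\<close> means
        \<open>\<tau> * (2 - \<alpha>) < 2\<close>; it follows from the threshold and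
        \<open>\<gamma> < 2\<close>.\<close>
      have "\<tau> * (2 - \<alpha>) * (4 - \<alpha> - \<gamma>) \<le> \<gamma> * (2 - \<alpha>)"
        using mult_right_mono[OF t, of "2 - \<alpha>"] alpha by (simp add: mult_ac)
      also have "\<dots> < 2 * (4 - \<alpha> - \<gamma>)"
        using mult_strict_right_mono[OF g2 den(2)] by (simp add: algebra_simps)
      finally have "\<tau> * (2 - \<alpha>) < 2"
        using den(1) by (rule mult_right_less_imp_less[OF _ less_imp_le])
      then have p0: "0 < p"
        using den by (simp add: p_eq)
      show ?thesis
      proof (rule that[of p r])
        show "0 < p" by fact
        show "0 < r"
          using den tau alpha by (simp add: r_def)
        show "step_exponent \<alpha> (\<alpha> * \<beta>) \<tau> = - p"
          using False True by (simp add: step_exponent_def tau_threshold_def p_def \<gamma>_def)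
        show "cost_exponent \<alpha> (\<alpha> * \<beta>) \<tau> = - ((\<tau> + 1) / r)"
          using False True tau alpha by (simp add: cost_exponent_def tau_threshold_def r_def \<gamma>_def)
        show "p + r * (2 / \<alpha>) = r + 1"
          using den alpha by (simp add: p_eq r_def divide_simps) (simp add: algebra_simps)
        show "r + 1 \<le> 2 * p + r * \<beta>"
          using den alpha t by (simp add: p_eq r_def \<beta>_eq divide_simps) (simp add: algebra_simps)
        show "r + 1 \<le> 2 * p + \<tau>"
          using den alpha by (simp add: p_eq r_def divide_simps) (simp add: algebra_simps)
      qed
    next
      case thr: False
      then have t: "\<gamma> < \<tau> * (4 - \<alpha> - \<gamma>)"
        using den by (simp add: pos_le_divide_eq not_le pos_divide_less_eq)
      define p r where "p = (2 - \<gamma>) / (4 - \<alpha> - \<gamma>)" and "r = \<alpha> / (4 - \<alpha> - \<gamma>)"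
      show ?thesis
      proof (rule that[of p r])
        show "0 < p" "0 < r"
          using den g2 alpha by (auto simp: p_def r_def)
        show "step_exponent \<alpha> (\<alpha> * \<beta>) \<tau> = - p"
          using False thr by (simp add: step_exponent_def tau_threshold_def p_def \<gamma>_def)
        show "cost_exponent \<alpha> (\<alpha> * \<beta>) \<tau> = - ((\<tau> + 1) / r)"
          using False thr by (simp add: cost_exponent_def tau_threshold_def r_def \<gamma>_def)
        show "p + r * (2 / \<alpha>) = r + 1"
          using den alpha by (simp add: p_def r_def divide_simps)
        show "r + 1 \<le> 2 * p + r * \<beta>"
          using den alpha by (simp add: p_def r_def \<beta>_eq divide_simps)
        show "r + 1 \<le> 2 * p + \<tau>"
          using den t by (simp add: p_def r_def divide_simps)
      qed
    qed
  qed
qed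

section \<open>Choice of the step-size constants and the complexity bound\<close>

theorem proposition1:
  fixes f :: "real ^ 'd \<Rightarrow> real"
    and grad_f :: "real ^ 'd \<Rightarrow> real ^ 'd"
    and g :: "nat \<Rightarrow> real ^ 'd \<Rightarrow> 's \<Rightarrow> real ^ 'd"
    and D :: "'s measure"
    and M :: "'w measure"
    and \<xi> :: "nat \<Rightarrow> nat \<Rightarrow> 'w \<Rightarrow> 's"
    and b :: "nat \<Rightarrow> real"
    and L \<alpha> \<mu> A B C \<beta> \<tau> \<gamma> :: real
  assumes bounded_below: "bdd_below (range f)"
    and gradient: "\<And>x. GDERIV f x :> grad_f x"
    and lipschitz: "L-lipschitz_on UNIV grad_f"
    and alpha: "1 \<le> \<alpha>" "\<alpha> \<le> 2"
    and mu: "0 < \<mu>"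
    and PL: "PL_condition \<alpha> \<mu> f grad_f"
    and prob_D: "prob_space D"
    and constants: "0 \<le> A" "0 \<le> B" "0 \<le> C"
    and beta: "0 < \<beta>" "\<beta> \<le> 1"
    and smooth: "\<And>k. expected_smoothness D (\<lambda>t. t powr \<beta>) A B C (b k) f grad_f (g k)"
    and tau: "0 \<le> \<tau>"
    and b_pos: "\<And>k. 0 < b k"
    and b_Theta: "b \<in> \<Theta>(\<lambda>k. real k powr \<tau>)"
    and gamma: "\<gamma> = \<alpha> * \<beta>"
    and prob_M: "prob_space M"
    and samples_indep: "prob_space.indep_vars M (\<lambda>_. D) (\<lambda>(k, t). \<xi> k t) UNIV"
    and samples_distr: "\<And>k t. distr M D (\<xi> k t) = D"
  shows "\<exists>(T :: nat) (\<eta> :: nat \<Rightarrow> real).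
           1 \<le> T \<and> (\<forall>k. 0 < \<eta> k) \<and>
           \<eta> \<in> \<Theta>(\<lambda>k. real k powr step_exponent \<alpha> \<gamma> \<tau>) \<and>
           (\<forall>x\<^sub>0. \<exists>K :: real \<Rightarrow> nat.
              (\<forall>\<epsilon>>0.
                 integrable M (\<lambda>\<omega>. f (sgd_restarts g \<eta> (\<lambda>k t. \<xi> k t \<omega>) T (K \<epsilon>) x\<^sub>0) - fstar f) \<and>
                 (\<integral>\<omega>. (f (sgd_restarts g \<eta> (\<lambda>k t. \<xi> k t \<omega>) T (K \<epsilon>) x\<^sub>0) - fstar f) \<partial>M) \<le> \<epsilon>) \<and>
              (\<lambda>\<epsilon>. real T * (\<Sum>k<K \<epsilon>. b k))
                \<in> O[at_right 0](\<lambda>\<epsilon>. \<epsilon> powr cost_exponent \<alpha> \<gamma> \<tau>))"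
proof -
  interpret M: prob_space M by fact
  \<comment> \<open>\<open>L\<close> may be 0, while the estimates divide by the Lipschitz
    constant.\<close>
  define L' where "L' = L + 1"
  have L: "0 \<le> L" "0 < L'"
    using lipschitz_on_nonneg[OF lipschitz] by (auto simp: L'_def)
  interpret PL_smooth f grad_f L' \<alpha> \<mu>
    using bounded_below gradient lipschitz_on_mono[OF lipschitz subset_refl, of L'] L alpha mu PL
    by unfold_locales (auto simp: L'_def)
  obtain p r where p: "0 < p" and r: "0 < r"
    and step_eq: "step_exponent \<alpha> \<gamma> \<tau> = - p" and cost_eq: "cost_exponent \<alpha> \<gamma> \<tau> = - ((\<tau> + 1) / r)"
    and exps: "p + r * (2 / \<alpha>) = r + 1" "r + 1 \<le> 2 * p + r * \<beta>" "r + 1 \<le> 2 * p + \<tau>"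
    using rate_exponents[OF alpha beta tau] gamma by metis
  define c where "c = 12 * r / \<mu>"
  have c: "0 < c"
    using r mu by (simp add: c_def)
  \<comment> \<open>\<open>Q\<close> collects the smallness conditions on the step-size:
    \<open>\<eta> k * Q \<le> 1\<close> implies each of them. The choice of \<open>N\<close> secures
    this for all \<open>k\<close>, and \<open>c\<close>, \<open>Q\<close>, \<open>N\<close> do not
    involve the starting point.\<close>
  define Q where "Q = L' + L' * B + 12 * (L' * A) / \<mu>"
  have Q: "0 < Q" "L' \<le> Q" "L' * B \<le> Q" "12 * (L' * A) / \<mu> \<le> Q"
    using L constants mu by (auto simp: Q_def add_pos_nonneg)
  define N where "N = Max {1, 2 * r, (c * Q) powr (1 / p)}"
  have N: "1 \<le> N" "2 * r \<le> N" "(c * Q) powr (1 / p) \<le> N"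
    unfolding N_def by (auto intro!: Max_ge)
  define \<eta> where "\<eta> k = c * (real k + N) powr - p" for k
  have \<eta>0: "0 < \<eta> k" for k
    using c N by (simp add: \<eta>_def)
  have \<eta>_le: "\<eta> k * Q \<le> 1" for k
  proof -
    have "(real k + N) powr - p \<le> ((c * Q) powr (1 / p)) powr - p"
      using N p c Q by (intro powr_mono2') auto
    also have "\<dots> = 1 / (c * Q)"
      using p c Q by (simp add: powr_powr powr_minus field_simps)
    finally show ?thesis
      using c Q by (simp add: \<eta>_def field_simps)
  qed
  have \<eta>_small: "z * \<eta> k \<le> 1" if "z \<le> Q" for z k
    using mult_right_mono[OF that less_imp_le[OF \<eta>0]] \<eta>_le[of k] by (metis mult.commute order_trans)
  have \<eta>_Theta: "\<eta> \<in> \<Theta>(\<lambda>k. real k powr step_exponent \<alpha> \<gamma> \<tau>)"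
    unfolding \<eta>_def step_eq using bigtheta_shift_powr[of N "- p"] N c by simp
  \<comment> \<open>The lower bound on \<open>b\<close> controls the noise \<open>C / b k\<close>;
    the upper bound that follows controls the cost.\<close>
  have "(\<lambda>k. (real k + N) powr \<tau>) \<in> O(b)"
    using bigtheta_shift_powr[of N \<tau>] b_Theta N
    by (meson bigthetaD1 bigtheta_sym landau_o.big_trans zero_le_one order_trans)
  then obtain lo where lo: "0 < lo" "\<And>k. (real k + N) powr \<tau> \<le> lo * b k"
    using bigo_sequentially_imp_bound b_pos by metis
  have "b \<in> O(\<lambda>k. (real k + 1) powr \<tau>)"
    using bigtheta_shift_powr[of 1 \<tau>] b_Theta
    by (meson bigthetaD1 bigtheta_sym landau_o.big_trans zero_le_one)
  then obtain H where H: "0 < H" "\<And>k. b k \<le> H * (real k + 1) powr \<tau>"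
    by (rule bigo_sequentially_imp_bound) auto
  have K: "\<exists>K :: real \<Rightarrow> nat.
      (\<forall>\<epsilon>>0. integrable M (\<lambda>\<omega>. f (sgd_restarts g \<eta> (\<lambda>k t. \<xi> k t \<omega>) 1 (K \<epsilon>) x\<^sub>0) - fstar f) \<and>
        (\<integral>\<omega>. (f (sgd_restarts g \<eta> (\<lambda>k t. \<xi> k t \<omega>) 1 (K \<epsilon>) x\<^sub>0) - fstar f) \<partial>M) \<le> \<epsilon>) \<and>
      (\<lambda>\<epsilon>. real 1 * (\<Sum>k<K \<epsilon>. b k)) \<in> O[at_right 0](\<lambda>\<epsilon>. \<epsilon> powr cost_exponent \<alpha> \<gamma> \<tau>)" for x\<^sub>0
  proof -
    define X where "X k \<omega> = sgd_restarts g \<eta> (\<lambda>k t. \<xi> k t \<omega>) 1 k x\<^sub>0" for k \<omega>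
    define d where "d k = (\<integral>\<omega>. gap (X k \<omega>) \<partial>M)" for k
    have X_Suc: "X (Suc k) \<omega> = X k \<omega> - \<eta> k *\<^sub>R g k (X k \<omega>) (\<xi> k 0 \<omega>)" for k \<omega>
      by (simp add: X_def Let_def)
    have g_meas: "(\<lambda>(x, s). g k x s) \<in> borel_measurable (borel \<Otimes>\<^sub>M D)" for k
      using smooth[of k] unfolding expected_smoothness_def by blast
    note sample = M.distr_sgd_restarts_sample[OF g_meas samples_indep]
    \<comment> \<open>With one inner step, iteration \<open>k\<close> uses the single sample
      \<open>\<xi> k 0\<close>.\<close>
    have law: "X k \<in> borel_measurable M" "\<xi> k 0 \<in> M \<rightarrow>\<^sub>M D"
      "distr M (borel \<Otimes>\<^sub>M D) (\<lambda>\<omega>. (X k \<omega>, \<xi> k 0 \<omega>)) = distr M borel (X k) \<Otimes>\<^sub>M D" for k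
      unfolding X_def[abs_def] using sample(3)[where \<eta> = \<eta> and T = 1 and k = k and x = x\<^sub>0 and t = 0]
      by (simp_all add: sample(1,2) samples_distr)
    have step: "integrable M (\<lambda>\<omega>. gap (X (Suc k) \<omega>))"
      "d (Suc k) \<le> d k - \<mu> * \<eta> k * d k powr (2 / \<alpha>) + L' * A * (\<eta> k)\<^sup>2 * d k powr \<beta>
        + L' * C / (2 * b k) * (\<eta> k)\<^sup>2" if "integrable M (\<lambda>\<omega>. gap (X k \<omega>))" for k
      unfolding X_Suc d_def
      by (rule sgd_step_expectation[OF prob_M prob_D law that smooth \<eta>0 \<eta>_small[OF Q(3)] beta constants(1)])+
    have int: "integrable M (\<lambda>\<omega>. gap (X k \<omega>))" for k
    proof (induction k)
      case 0
      then show ?case by (simp add: X_def)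
    next
      case (Suc k)
      then show ?case by (rule step(1))
    qed
    obtain R where R: "0 < R" "\<And>k. d k \<le> R * (real k + N) powr - r"
    proof (rule recursion_rate[where \<theta> = "2 / \<alpha>" and d = d and w = "\<lambda>k. L' * C / (2 * b k)"
          and a = "L' * A" and W = "L' * C * lo / 2" and c = c])
      show "d (Suc k) \<le> d k - \<mu> * \<eta> k * d k powr (2 / \<alpha>) + L' * A * (\<eta> k)\<^sup>2 * d k powr \<beta>
          + L' * C / (2 * b k) * (\<eta> k)\<^sup>2" for k
        by (rule step(2)[OF int])
      show "\<mu> * d k powr (2 / \<alpha>) \<le> L' * d k" for k
        unfolding d_def by (rule expectation_gap_powr_le[OF prob_M int])
      show "0 \<le> d k" for k
        by (simp add: d_def gap_nonneg)
      show "L' * C / (2 * b k) \<le> L' * C * lo / 2 * (real k + N) powr - \<tau>" for k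
      proof -
        have "1 / b k \<le> lo * (real k + N) powr - \<tau>"
          using lo(2)[of k] b_pos[of k] N by (simp add: powr_minus field_simps)
        from mult_left_mono[OF this, of "L' * C / 2"] show ?thesis
          using L constants by (simp add: mult_ac)
      qed
      show "L' * A * \<eta> k \<le> \<mu> / 12" for k
        using \<eta>_small[OF Q(4), of k] mu by (simp add: field_simps)
      show "2 / \<alpha> \<le> 2"
        using alpha by (simp add: field_simps)
      show "L' * \<eta> k \<le> 1" for k
        by (rule \<eta>_small[OF Q(2)])
    qed (use alpha beta mu L constants r N exps lo in \<open>auto simp: \<eta>_def c_def\<close>)
    define K where "K \<epsilon> = nat \<lceil>(R / \<epsilon>) powr (1 / r)\<rceil>" for \<epsilon>
    note cost = rate_imp_cost[OF r R(1) tau less_imp_le[OF b_pos] H(2,1), folded K_def]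
    \<comment> \<open>The shift \<open>N\<close> in the rate only helps, since \<open>K\<close> is
      chosen for the unshifted rate.\<close>
    have "d (K \<epsilon>) \<le> \<epsilon>" if "0 < \<epsilon>" for \<epsilon>
      using R(2)[of "K \<epsilon>"] cost(2)[OF that, of N] N by linarith
    then show ?thesis
      using int cost(1) unfolding cost_eq
      by (intro exI[of _ K]) (simp add: d_def gap_def X_def)
  qed
  show ?thesis
    by (rule exI[of _ 1], rule exI[of _ \<eta>]) (intro conjI allI K \<eta>0 \<eta>_Theta order_refl)
qed

end
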